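(* The multi-objective energy trading optimization problem defined in the context is not convex.
   Context: Let $G,L\ge 1$ be integers (numbers of distributed energy resources, "DERs", indexed $1,\dots,G$, and of loads, indexed $1,\dots,L$). Index $0$ denotes the main power supplier (PCC). Fixed data: surplus energies $E_i\ge 0$ and maximum prices $P_i$ ($1\le i\le G$), demands $D_i\ge0$ ($1\le i\le L$), PCC buying prices $\gamma_i^{\mathrm{PCC}}>0$ ($1\le i\le G$), PCC selling prices $\pi_i^{\mathrm{PCC}}>0$ ($1\le i\le L$), a maximum discount factor $\alpha\in[0,1]$, and target demand vectors $\bm{d}^{\diamond}_{i,\cdot}$ ($1\le i\le L$) of the same size as the rows of $\bm{D}$ below. Variables: prices $\bm{P}=(p_{i,j})\in\mathbb{R}_{++}^{G\times L}$ with $p_{i,j}\le P_i$; allocations $\bm{H}=(h_{i,j})\in\mathbb{R}_+^{G\times(L+1)}$, columns indexed $0,\dots,L$, with $\sum_{j=0}^L h_{i,j}=E_i$ for all $i$; demands $\bm{D}=(d_{i,j})\in\mathbb{R}_+^{L\times(G+1)}$, columns indexed $0,\dots,G$, with $\sum_{j=0}^G d_{i,j}=D_i$ for all $i$; discounts $\bm{S}=(s_{i,j})\in\mathbb{R}_+^{L\times G}$ with $s_{i,j}\le\alpha p_{j,i}$. Here $\mathbb{R}_{++}$ denotes positive reals and $\mathbb{R}_+$ nonnegative reals. Objective functions: $U_i^{\mathcal{G}}=\sum_{j=1}^{L}p_{i,j}h_{i,j}+\bigl(E_i-\sum_{j=1}^L h_{i,j}\bigr)\gamma_i^{\mathrm{PCC}}$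 for $1\le i\le G$; $U_i^{\mathcal{L}}=\sum_{j=1}^{G}(p_{j,i}-s_{i,j})d_{i,j}+\bigl(D_i-\sum_{j=1}^G d_{i,j}\bigr)\pi_i^{\mathrm{PCC}}$ for $1\le i\le L$; $U_i^{\mathrm{PCC}}=\|\bm{d}_{i,\cdot}-\bm{d}^{\diamond}_{i,\cdot}\|_2^2$ for $1\le i\le L$. The multi-objective energy trading problem is to minimize over $(\bm{P},\bm{H},\bm{D},\bm{S})$ the vector with components $(U_i^{\mathcal{G}})^{-1}$ ($1\le i\le G$), $U_i^{\mathcal{L}}$ ($1\le i\le L$), $U_i^{\mathrm{PCC}}$ ($1\le i\le L$), subject to $\sum_{j=1}^L h_{i,j}\le E_i$, $\sum_{j=1}^G d_{i,j}\le D_i$, $p_{i,j}\le P_i$, $s_{j,i}\le\alpha p_{i,j}$, and $h_{i,j}=d_{j,i}$ for $1\le i\le G$, $1\le j\le L$. A multi-objective minimization problem is convex if its feasible set and all of its objective functions are convex.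
   Formalization: The formal theorem additionally assumes that all maximum prices P_i are positive, some surplus energy E_i is positive, and some demand D_i is positive; otherwise the feasible set is empty or no trade is possible, and the problem is convex (or the reciprocal of U_i^G is undefined). *)

theory Defs
  imports "HOL-Analysis.Analysis"
begin

text \<open>
  The finite types \<open>'g\<close> and \<open>'l\<close> index the DERs and the loads, so that \<open>G = CARD('g)\<close> and
  \<open>L = CARD('l)\<close>. Where an index may also be \<open>0\<close> (the PCC), it ranges over an option type,
  with \<open>None\<close> for \<open>0\<close> and \<open>Some i\<close> for \<open>i \<ge> 1\<close>.
  A point is a tuple \<open>(P, H, D, S)\<close> of prices, allocations, demands and discounts.
\<close>

type_synonym ('g, 'l) trade =
  "(real^'l^'g) \<times> (real^('l option)^'g) \<times> (real^('g option)^'l) \<times> (real^'g^'l)"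

definition trade_domain ::
  "('g::finite \<Rightarrow> real) \<Rightarrow> ('g \<Rightarrow> real) \<Rightarrow> ('l::finite \<Rightarrow> real) \<Rightarrow> real \<Rightarrow> ('g, 'l) trade set" where
  "trade_domain E Pmax Dem \<alpha> = {(P, H, D, S).
     (\<forall>i j. 0 < P $ i $ j \<and> P $ i $ j \<le> Pmax i) \<and>
     (\<forall>i k. 0 \<le> H $ i $ k) \<and> (\<forall>i. (\<Sum>k\<in>UNIV. H $ i $ k) = E i) \<and>
     (\<forall>i k. 0 \<le> D $ i $ k) \<and> (\<forall>i. (\<Sum>k\<in>UNIV. D $ i $ k) = Dem i) \<and>
     (\<forall>i j. 0 \<le> S $ i $ j \<and> S $ i $ j \<le> \<alpha> * P $ j $ i)}"

text \<open>
  The inequality constraints below are already implied by membership in \<open>trade_domain\<close>; they are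
  repeated because they are listed explicitly as constraints of the problem.
\<close>

definition feasible_set ::
  "('g::finite \<Rightarrow> real) \<Rightarrow> ('g \<Rightarrow> real) \<Rightarrow> ('l::finite \<Rightarrow> real) \<Rightarrow> real \<Rightarrow> ('g, 'l) trade set" where
  "feasible_set E Pmax Dem \<alpha> = {(P, H, D, S) \<in> trade_domain E Pmax Dem \<alpha>.
     (\<forall>i. (\<Sum>j\<in>UNIV. H $ i $ Some j) \<le> E i) \<and>
     (\<forall>i. (\<Sum>j\<in>UNIV. D $ i $ Some j) \<le> Dem i) \<and>
     (\<forall>i j. P $ i $ j \<le> Pmax i) \<and>
     (\<forall>i j. S $ j $ i \<le> \<alpha> * P $ i $ j) \<and>
     (\<forall>i j. H $ i $ Some j = D $ j $ Some i)}"

definition U_DER ::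
  "('g::finite \<Rightarrow> real) \<Rightarrow> ('g \<Rightarrow> real) \<Rightarrow> 'g \<Rightarrow> ('g, 'l::finite) trade \<Rightarrow> real" where
  "U_DER E \<gamma>PCC i = (\<lambda>(P, H, D, S).
     (\<Sum>j\<in>UNIV. P $ i $ j * H $ i $ Some j) + (E i - (\<Sum>j\<in>UNIV. H $ i $ Some j)) * \<gamma>PCC i)"

definition U_load ::
  "('l::finite \<Rightarrow> real) \<Rightarrow> ('l \<Rightarrow> real) \<Rightarrow> 'l \<Rightarrow> ('g::finite, 'l) trade \<Rightarrow> real" where
  "U_load Dem \<pi>PCC i = (\<lambda>(P, H, D, S).
     (\<Sum>j\<in>UNIV. (P $ j $ i - S $ i $ j) * D $ i $ Some j)
       + (Dem i - (\<Sum>j\<in>UNIV. D $ i $ Some j)) * \<pi>PCC i)"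

definition U_PCC ::
  "real^('g option)^'l \<Rightarrow> 'l \<Rightarrow> ('g::finite, 'l::finite) trade \<Rightarrow> real" where
  "U_PCC Dtarget i = (\<lambda>(P, H, D, S). (norm (D $ i - Dtarget $ i))\<^sup>2)"

text \<open>
  If \<open>E i = 0\<close>, then \<open>U_DER\<close> vanishes identically on the feasible set, and its
  reciprocal is the constant \<open>0\<close> there, since \<open>inverse 0 = 0\<close>.
\<close>

definition trade_objective ::
  "('g::finite \<Rightarrow> real) \<Rightarrow> ('l::finite \<Rightarrow> real) \<Rightarrow> ('g \<Rightarrow> real) \<Rightarrow> ('l \<Rightarrow> real) \<Rightarrow>
   real^('g option)^'l \<Rightarrow> ('g, 'l) trade \<Rightarrow> real^('g + 'l + 'l)" where
  "trade_objective E Dem \<gamma>PCC \<pi>PCC Dtarget x = (\<chi> k. case k of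
       Inl i \<Rightarrow> inverse (U_DER E \<gamma>PCC i x)
     | Inr (Inl i) \<Rightarrow> U_load Dem \<pi>PCC i x
     | Inr (Inr i) \<Rightarrow> U_PCC Dtarget i x)"

definition convex_multiobjective_problem ::
  "'x::real_vector set \<Rightarrow> ('x \<Rightarrow> real^'k::finite) \<Rightarrow> bool" where
  "convex_multiobjective_problem F f \<longleftrightarrow> convex F \<and> (\<forall>k. convex_on F (\<lambda>x. f x $ k))"

end

theory Submission
  imports Defs
begin

text \<open>
  A payment is the product of a price and a traded amount, hence bilinear, and so it is strictly
  concave along any segment on which the price rises while the amount falls. Trading only between
  one DER and one load with positive energy and demand gives such a segment inside the feasible
  set, and along it the cost of that load is not convex.
\<close>

lemma sum_UNIV_option:
  fixes f :: "'a::finite option \<Rightarrow> 'b::comm_monoid_add"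
  shows "(\<Sum>k\<in>UNIV. f k) = f None + (\<Sum>j\<in>UNIV. f (Some j))"
  by (simp add: UNIV_option_conv sum.reindex)

text \<open>Every entry is affine in the pair \<open>(c, t)\<close>, so segments of parameters
  become segments of trades. The \<open>None\<close> entries absorb what is not traded, which keeps
  the row sums fixed, and the zero discount is admissible even for \<alpha> = 0.\<close>

definition single_trade ::
  "('g::finite \<Rightarrow> real) \<Rightarrow> ('g \<Rightarrow> real) \<Rightarrow> ('l::finite \<Rightarrow> real) \<Rightarrow> 'g \<Rightarrow> 'l \<Rightarrow> real \<Rightarrow> real \<Rightarrow> ('g, 'l) trade"
  where
  "single_trade E Pmax Dem g l c t =
     ((\<chi> i j. c * Pmax i),
      (\<chi> i k. case k of None \<Rightarrow> E i - (if i = g then t else 0)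
                | Some j \<Rightarrow> if i = g \<and> j = l then t else 0),
      (\<chi> j k. case k of None \<Rightarrow> Dem j - (if j = l then t else 0)
                | Some i \<Rightarrow> if i = g \<and> j = l then t else 0),
      0)"

lemma sum_if_conj:
  fixes t :: "'b::comm_monoid_add"
  shows "(\<Sum>j\<in>UNIV. if P \<and> j = (l::'a::finite) then t else 0) = (if P then t else 0)"
    and "(\<Sum>j\<in>UNIV. if j = (l::'a::finite) \<and> P then t else 0) = (if P then t else 0)"
  by (cases P; simp)+

lemma single_trade_feasible:
  assumes "\<And>i. 0 \<le> E i" "\<And>i. 0 < Pmax i" "\<And>j. 0 \<le> Dem j" "0 \<le> \<alpha>"
    and "0 < c" "c \<le> 1" "0 \<le> t" "t \<le> E g" "t \<le> Dem l"
  shows "single_trade E Pmax Dem g l c t \<in> feasible_set E Pmax Dem \<alpha>"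
proof -
  have "c * Pmax i \<le> Pmax i" for i
    using assms(2)[of i] assms(6) by (simp add: mult_le_cancel_right1)
  moreover have "0 \<le> \<alpha> * (c * Pmax i)" for i
    using assms(2)[of i] assms(4,5) by simp
  ultimately show ?thesis
    using assms
    by (auto simp: single_trade_def feasible_set_def trade_domain_def sum_UNIV_option sum_if_conj
        split: option.split)
qed

text \<open>Only the product \<open>c * t\<close> fails to be affine in the parameters; the PCC term
  cancels in any midpoint comparison.\<close>

lemma U_load_single_trade:
  "U_load Dem \<pi>PCC l (single_trade E Pmax Dem g l c t) =
     c * Pmax g * t + (Dem l - t) * \<pi>PCC l"
  by (simp add: U_load_def single_trade_def if_distrib[of "(*) _"] cong: if_cong)

lemma single_trade_midpoint:
  "(1/2) *\<^sub>R single_trade E Pmax Dem g l c t + (1/2) *\<^sub>R single_trade E Pmax Dem g l c' t' =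
     single_trade E Pmax Dem g l ((c + c') / 2) ((t + t') / 2)"
  by (auto simp: single_trade_def vec_eq_iff field_simps split: option.split)

theorem proposition6:
  fixes E Pmax \<gamma>PCC :: "'g::finite \<Rightarrow> real"
    and Dem \<pi>PCC :: "'l::finite \<Rightarrow> real"
    and \<alpha> :: real
    and Dtarget :: "real^('g option)^'l"
  assumes "\<forall>i. 0 \<le> E i"
    and "\<forall>i. 0 < Pmax i"
    and "\<forall>i. 0 \<le> Dem i"
    and "\<forall>i. 0 < \<gamma>PCC i"
    and "\<forall>i. 0 < \<pi>PCC i"
    and "0 \<le> \<alpha>" and "\<alpha> \<le> 1"
    and "\<exists>i. 0 < E i"
    and "\<exists>i. 0 < Dem i"
  shows "\<not> convex_multiobjective_problem (feasible_set E Pmax Dem \<alpha>)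
           (trade_objective E Dem \<gamma>PCC \<pi>PCC Dtarget)"
proof
  assume conv: "convex_multiobjective_problem (feasible_set E Pmax Dem \<alpha>)
    (trade_objective E Dem \<gamma>PCC \<pi>PCC Dtarget)"
  obtain g l where g: "0 < E g" and l: "0 < Dem l"
    using assms(8,9) by blast
  \<comment> \<open>The largest amount that keeps both PCC remainders nonnegative.\<close>
  define m where "m = min (E g) (Dem l)"
  have m: "0 < m" "m \<le> E g" "m \<le> Dem l"
    using g l by (auto simp: m_def)
  let ?X = "single_trade E Pmax Dem g l"
  let ?F = "feasible_set E Pmax Dem \<alpha> :: ('g, 'l) trade set"
  let ?U = "U_load Dem \<pi>PCC l :: ('g, 'l) trade \<Rightarrow> real"
  have "convex_on ?F (\<lambda>x. trade_objective E Dem \<gamma>PCC \<pi>PCC Dtarget x $ Inr (Inl l))"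
    using conv unfolding convex_multiobjective_problem_def by blast
  then have "convex_on ?F ?U"
    by (simp add: trade_objective_def)
  \<comment> \<open>From the first endpoint to the second the price factor rises while the amount
    falls to 0. The factor starts at 1/2 because prices must stay positive.\<close>
  moreover have "?X (1/2) m \<in> ?F" "?X 1 0 \<in> ?F"
    using assms m by (auto intro!: single_trade_feasible)
  ultimately have "?U ((1/2) *\<^sub>R ?X (1/2) m + (1/2) *\<^sub>R ?X 1 0)
      \<le> (1/2) * ?U (?X (1/2) m) + (1/2) * ?U (?X 1 0)"
    using convex_onD[of ?F ?U "1/2" "?X (1/2) m" "?X 1 0"] by simp
  \<comment> \<open>At the midpoint \<open>c = 3/4\<close> and \<open>t = m / 2\<close>, so the
    payment is 3/8 of \<open>Pmax g * m\<close>, whereas the endpoint payments average 1/4 of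
    it.\<close>
  then have "Pmax g * m \<le> 0"
    unfolding single_trade_midpoint U_load_single_trade by (simp add: field_simps)
  moreover have "0 < Pmax g * m"
    using assms(2) m(1) by simp
  ultimately show False
    by linarith
qed

end
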